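(* Let $d\ge1$ and let $\mu_0 \in GMM_d(K_0)$ and $\mu_1 \in GMM_d(K_1)$ be two Gaussian mixtures on $\mathbb{R}^d$ such that $\mu_1$ cannot be written $T\#\mu_0$ with $T:\mathbb{R}^d\to\mathbb{R}^d$ affine. Assume also that $\mu_0$ is absolutely continuous with respect to the Lebesgue measure. Let $\gamma \in \Pi(\mu_0,\mu_1)$ be an optimal transport plan between $\mu_0$ and $\mu_1$ for $W_2$. Then $\gamma$ does not belong to $GMM_{2d}(\infty)$.
   Context: Gaussian distributions $\mathcal{N}(m,\Sigma)$ on $\mathbb{R}^n$ may be degenerate ($\Sigma$ symmetric positive semi-definite; Dirac masses are included). $GMM_n(K)$ is the set of probability measures on $\mathbb{R}^n$ that can be written $\sum_{k=1}^{K}\pi_k\mathcal{N}(m_k,\Sigma_k)$ with $\pi_k\ge0$, $\sum_k\pi_k=1$, and $GMM_n(\infty)=\bigcup_K GMM_n(K)$ (finite Gaussian mixtures). $T\#\mu$ is the push-forward of $\mu$ by $T$. $\Pi(\mu_0,\mu_1)$ is the set of probability measures on $\mathbb{R}^d\times\mathbb{R}^d\cong\mathbb{R}^{2d}$ with marginals $\mu_0,\mu_1$. An optimal transport plan for $W_2$ is a minimizer of $\int\|y_0-y_1\|^2d\gamma(y_0,y_1)$ over $\gamma\in\Pi(\mu_0,\mu_1)$. *)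

theory Defs
  imports "HOL-Probability.Probability"
begin

text \<open>Everything is stated for an arbitrary type of class \<open>euclidean_space\<close>, so that it applies to
  \<open>real ^ 'd\<close> and to the product \<open>(real ^ 'd) \<times> (real ^ 'd)\<close>, which carries the Euclidean structure of
  dimension \<open>2 * CARD('d)\<close>. Accordingly, a covariance matrix is represented by its linear operator.\<close>

definition sym_psd :: "('a::euclidean_space \<Rightarrow> 'a) \<Rightarrow> bool" where
  "sym_psd S \<longleftrightarrow> linear S \<and> (\<forall>x y. S x \<bullet> y = x \<bullet> S y) \<and> (\<forall>x. 0 \<le> x \<bullet> S x)"

definition std_gaussian :: "'a::euclidean_space measure" where
  "std_gaussian = density lborel (\<lambda>x. ennreal (\<Prod>b\<in>Basis. std_normal_density (x \<bullet> b)))"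

text \<open>\<open>gaussian_law m S \<nu>\<close> says that \<open>\<nu>\<close> is the normal law with mean \<open>m\<close> and covariance \<open>S\<close>: the law of
  \<open>m + A Z\<close>, where \<open>Z\<close> is standard Gaussian and \<open>A\<close> is any factor of \<open>S\<close>, that is \<open>S = A A\<^sup>T\<close>.
  The law does not depend on the choice of \<open>A\<close>, and a factor exists for every symmetric positive
  semi-definite \<open>S\<close>; \<open>S = 0\<close> gives the Dirac mass at \<open>m\<close>.\<close>

definition gaussian_law :: "'a::euclidean_space \<Rightarrow> ('a \<Rightarrow> 'a) \<Rightarrow> 'a measure \<Rightarrow> bool" where
  "gaussian_law m S \<nu> \<longleftrightarrow> sym_psd S \<and>
     (\<exists>A :: 'a \<Rightarrow> 'a. linear A \<and> S = A \<circ> adjoint A \<and> \<nu> = distr std_gaussian borel (\<lambda>z. m + A z))"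

lemma prob_space_std_gaussian: "prob_space (std_gaussian :: 'a::euclidean_space measure)"
proof
  have "emeasure (std_gaussian :: 'a measure) (space std_gaussian)
      = nn_integral lborel (\<lambda>x::'a. ennreal (\<Prod>b\<in>Basis. std_normal_density (x \<bullet> b)))"
    by (simp add: std_gaussian_def emeasure_density)
  also have "\<dots> = nn_integral lborel (\<lambda>x::'a. \<Prod>b\<in>Basis. ennreal (std_normal_density (x \<bullet> b)))"
    by (simp add: prod_ennreal)
  also have "\<dots> = (\<Prod>b\<in>(Basis::'a set). (\<integral>\<^sup>+x. ennreal (std_normal_density x) \<partial>lborel))"
    by (rule nn_integral_lborel_prod) auto
  also have "(\<integral>\<^sup>+x. ennreal (std_normal_density x) \<partial>lborel) = 1"
    using prob_space.emeasure_space_1[OF prob_space_normal_density[of 1 0]]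
    by (simp add: emeasure_density)
  finally show "emeasure (std_gaussian :: 'a measure) (space std_gaussian) = 1" by simp
qed

lemma sym_psd_sum_rank_one:
  fixes S :: "'a::euclidean_space \<Rightarrow> 'a"
  assumes "sym_psd S" "finite I" "DIM('a) \<le> card I + dim {x. S x = 0}"
  shows "\<exists>v. \<forall>x. S x = (\<Sum>i\<in>I. (v i \<bullet> x) *\<^sub>R v i)"
  using assms(2,1,3)
proof (induction I arbitrary: S rule: finite_induct)
  case empty
  then have lin: "linear S" by (simp add: sym_psd_def)
  have "subspace {x. S x = 0}"
    using lin by (auto simp: subspace_def linear_0 linear_add linear_cmul)
  moreover have "dim {x. S x = 0} = DIM('a)"
    using empty dim_subset_UNIV[of "{x. S x = 0}"] by simp
  ultimately have "{x. S x = 0} = UNIV"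
    by (metis dim_eq_full span_eq_iff)
  then show ?case by auto
next
  case (insert j I)
  have lin: "linear S" and sym: "\<And>x y. S x \<bullet> y = x \<bullet> S y" and psd: "\<And>x. 0 \<le> x \<bullet> S x"
    using insert.prems(1) by (auto simp: sym_psd_def)
  note L = linear_add[OF lin] linear_cmul[OF lin] linear_diff[OF lin] linear_0[OF lin]
  have CS: "(x \<bullet> S y)\<^sup>2 \<le> (x \<bullet> S x) * (y \<bullet> S y)" for x y
  proof -
    have q: "0 \<le> x \<bullet> S x + 2 * t * (x \<bullet> S y) + t\<^sup>2 * (y \<bullet> S y)" for t
    proof -
      have "y \<bullet> S x = x \<bullet> S y" by (metis sym inner_commute)
      then show ?thesis using psd[of "x + t *\<^sub>R y"]
        by (simp add: L inner_simps power2_eq_square algebra_simps)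
    qed
    show ?thesis
    proof (cases "y \<bullet> S y = 0")
      case True
      have "x \<bullet> S y = 0"
      proof (rule ccontr)
        assume "x \<bullet> S y \<noteq> 0"
        then show False
          using q[of "- (x \<bullet> S x + 1) / (2 * (x \<bullet> S y))"] True by (simp add: field_simps)
      qed
      then show ?thesis using True by simp
    next
      case False
      then have pos: "y \<bullet> S y > 0" using psd[of y] by simp
      have "0 \<le> x \<bullet> S x - (x \<bullet> S y)\<^sup>2 / (y \<bullet> S y)"
        using q[of "- (x \<bullet> S y) / (y \<bullet> S y)"] False
        by (simp add: field_simps power2_eq_square)
      then show ?thesis using pos by (simp add: field_simps)
    qed
  qed
  show ?case
  proof (cases "\<forall>x. S x = 0")
    case True
    then show ?thesis by (intro exI[of _ "\<lambda>_. 0"]) simp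
  next
    case False
    then obtain y where "S y \<noteq> 0" by blast
    then have "0 < y \<bullet> S y"
      using CS[of "S y" y] psd[of y] by (cases "y \<bullet> S y = 0") auto
    define c where "c = y \<bullet> S y"
    have c: "c > 0" using \<open>0 < y \<bullet> S y\<close> by (simp add: c_def)
    define w where "w = (1 / sqrt c) *\<^sub>R S y"
    define S' where "S' x = S x - (w \<bullet> x) *\<^sub>R w" for x
    have ww: "(w \<bullet> x) *\<^sub>R w = ((x \<bullet> S y) / c) *\<^sub>R S y" for x
      using c by (simp add: w_def inner_commute)
    have S': "S' x = S x - ((x \<bullet> S y) / c) *\<^sub>R S y" for x by (simp add: S'_def ww)
    have lin': "linear S'"
      by (rule linearI) (simp_all add: S' L inner_simps algebra_simps add_divide_distrib)
    have psd': "sym_psd S'"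
      unfolding sym_psd_def
    proof (intro conjI allI lin')
      fix x z
      show "S' x \<bullet> z = x \<bullet> S' z"
        using sym[of x z] by (simp add: S' inner_simps inner_commute)
      have "(x \<bullet> S y)\<^sup>2 / c \<le> x \<bullet> S x"
        using CS[of x y] c by (simp add: c_def field_simps)
      then show "0 \<le> x \<bullet> S' x"
        by (simp add: S' inner_simps power2_eq_square)
    qed
    let ?K = "{x. S x = 0}" and ?K' = "{x. S' x = 0}"
    have "y \<in> ?K'" using c by (simp add: S' c_def)
    have "?K \<subseteq> ?K'"
    proof
      fix x assume "x \<in> ?K"
      then have "x \<bullet> S y = 0" by (metis sym inner_zero_left mem_Collect_eq)
      then show "x \<in> ?K'" using \<open>x \<in> ?K\<close> by (simp add: S')
    qed
    have "span ?K = ?K"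
      by (rule span_eq_iff[THEN iffD2]) (auto simp: subspace_def L)
    then have "y \<notin> span ?K" using \<open>S y \<noteq> 0\<close> by blast
    then have "dim (Set.insert y ?K) = Suc (dim ?K)" by (simp add: dim_insert)
    moreover have "dim (Set.insert y ?K) \<le> dim ?K'"
      using \<open>y \<in> ?K'\<close> \<open>?K \<subseteq> ?K'\<close> by (intro dim_subset) auto
    ultimately have "DIM('a) \<le> card I + dim ?K'"
      using insert.prems(2) insert.hyps by simp
    from insert.IH[OF psd' this]
    obtain v where v: "\<And>x. S' x = (\<Sum>i\<in>I. (v i \<bullet> x) *\<^sub>R v i)" by blast
    have "S x = (\<Sum>i\<in>Set.insert j I. ((v(j := w)) i \<bullet> x) *\<^sub>R (v(j := w)) i)" for x
    proof -
      have "(\<Sum>i\<in>I. ((v(j := w)) i \<bullet> x) *\<^sub>R (v(j := w)) i) = S' x"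
        unfolding v using insert.hyps by (intro sum.cong) auto
      then show ?thesis using insert.hyps by (simp add: S'_def)
    qed
    then show ?thesis by blast
  qed
qed

lemma sym_psd_factor:
  fixes S :: "'a::euclidean_space \<Rightarrow> 'a"
  assumes "sym_psd S"
  shows "\<exists>A :: 'a \<Rightarrow> 'a. linear A \<and> S = A \<circ> adjoint A"
proof -
  obtain v where v: "\<And>x. S x = (\<Sum>b\<in>(Basis::'a set). (v b \<bullet> x) *\<^sub>R v b)"
    using sym_psd_sum_rank_one[OF assms, of "Basis :: 'a set"] by auto
  define A :: "'a \<Rightarrow> 'a" where "A x = (\<Sum>b\<in>Basis. (b \<bullet> x) *\<^sub>R v b)" for x
  have "linear A"
    by (rule linearI)
       (simp_all add: A_def inner_simps algebra_simps sum.distrib scaleR_sum_right)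
  have "adjoint A = (\<lambda>y. \<Sum>b\<in>Basis. (v b \<bullet> y) *\<^sub>R b)"
    by (rule adjoint_unique) (simp add: A_def inner_sum_left inner_sum_right inner_commute mult.commute)
  then have "A (adjoint A x) = S x" for x
    unfolding v by (simp add: A_def inner_commute[of _ "\<Sum>b\<in>Basis. _ b *\<^sub>R b"])
  then show ?thesis using \<open>linear A\<close> by (intro exI[of _ A]) auto
qed

lemma gaussian_law_exists:
  fixes m :: "'a::euclidean_space" and S :: "'a \<Rightarrow> 'a"
  assumes "sym_psd S"
  shows "\<exists>\<nu>. gaussian_law m S \<nu>"
  using assms sym_psd_factor[OF assms] by (auto simp: gaussian_law_def)

text \<open>The HOL type of measures has no addition, so the convex combination is spelled out on events.\<close>

definition GMM :: "nat \<Rightarrow> 'a::euclidean_space measure set" where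
  "GMM K = {\<mu>. prob_space \<mu> \<and> sets \<mu> = sets borel \<and>
     (\<exists>\<pi> m S \<nu>.
        (\<forall>k<K. 0 \<le> \<pi> k \<and> gaussian_law (m k) (S k) (\<nu> k)) \<and> (\<Sum>k<K. \<pi> k) = (1::real) \<and>
        (\<forall>E\<in>sets borel. measure \<mu> E = (\<Sum>k<K. \<pi> k * measure (\<nu> k) E)))}"

definition GMM_inf :: "'a::euclidean_space measure set" where
  "GMM_inf = (\<Union>K. GMM K)"

definition couplings ::
    "'a::euclidean_space measure \<Rightarrow> 'a measure \<Rightarrow> ('a \<times> 'a) measure set" where
  "couplings \<mu> \<nu> = {\<gamma>. prob_space \<gamma> \<and> sets \<gamma> = sets borel \<and>
     distr \<gamma> borel fst = \<mu> \<and> distr \<gamma> borel snd = \<nu>}"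

definition quadratic_cost :: "('a::euclidean_space \<times> 'a) measure \<Rightarrow> ennreal" where
  "quadratic_cost \<gamma> = (\<integral>\<^sup>+(y0, y1). ennreal ((norm (y0 - y1))\<^sup>2) \<partial>\<gamma>)"

definition W2_optimal_plan ::
    "'a::euclidean_space measure \<Rightarrow> 'a measure \<Rightarrow> ('a \<times> 'a) measure \<Rightarrow> bool" where
  "W2_optimal_plan \<mu> \<nu> \<gamma> \<longleftrightarrow> \<gamma> \<in> couplings \<mu> \<nu> \<and>
     (\<forall>\<gamma>'\<in>couplings \<mu> \<nu>. quadratic_cost \<gamma> \<le> quadratic_cost \<gamma>')"

end

theory Submission
  imports Defs
begin

text \<open>
  The reason is that an optimal plan is monotone, while a monotone union of affine subspaces that
  project onto the whole first factor is the graph of a single affine map. Suppose that an optimal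
  plan \<open>\<gamma>\<close> is a finite Gaussian mixture. Its cost is then finite, and if \<open>\<langle>x - x', y - y'\<rangle> < 0\<close> had
  positive probability for two independent pairs \<open>(x, y)\<close> and \<open>(x', y')\<close> drawn from \<open>\<gamma>\<close>, exchanging
  \<open>y\<close> and \<open>y'\<close> on this event would keep both marginals and lower the cost
  (\<open>optimal_plan_AE_monotone\<close>).

  Each Gaussian component of positive weight has an affine subspace \<open>m + range A\<close> as its support,
  and on these supports the almost sure inequality \<open>\<langle>x - x', y - y'\<rangle> \<ge> 0\<close> becomes an inequality
  between all points, by continuity (\<open>AE_gaussian_closed_imp_all\<close>). Absolute continuity of the first
  marginal forces each subspace to project onto the whole space
  (\<open>affine_image_in_no_null_set_imp_surj\<close>). Let two points \<open>(x, y)\<close> and \<open>(x, y')\<close>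
  of such subspaces lie over the same \<open>x\<close>. Moving the second one along its subspace in a direction
  that projects to \<open>y - y'\<close> gives an inequality between a term linear
  in the displacement and a quadratic one, which fails for small displacements unless \<open>y = y'\<close>
  (\<open>monotone_affine_pair_agree\<close>). Hence all the subspaces are the graph of one affine map \<open>T\<close>, so
  that \<open>\<gamma>\<close> lives on this graph and \<open>\<mu>1 = T # \<mu>0\<close>, which is excluded.
\<close>

section \<open>Finite mixtures\<close>

text \<open>
  Mixtures are described by their values on events; induction on the integrand, from indicators to
  monotone limits, extends the description to integrals.
\<close>

lemma nn_integral_mixture:
  fixes \<gamma> :: "'a::topological_space measure" and \<nu> :: "'i \<Rightarrow> 'a measure" and w :: "'i \<Rightarrow> ennreal"
  assumes "finite I"
    and [measurable_cong]: "sets \<gamma> = sets borel" "\<And>k. k \<in> I \<Longrightarrow> sets (\<nu> k) = sets borel"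
    and mix: "\<And>E. E \<in> sets borel \<Longrightarrow> emeasure \<gamma> E = (\<Sum>k\<in>I. w k * emeasure (\<nu> k) E)"
    and f: "f \<in> borel_measurable borel"
  shows "(\<integral>\<^sup>+x. f x \<partial>\<gamma>) = (\<Sum>k\<in>I. w k * (\<integral>\<^sup>+x. f x \<partial>\<nu> k))"
  using f
proof (induction rule: borel_measurable_induct)
  case (cong f g)
  then have "f = g" by auto
  then show ?case using cong by simp
next
  case (set E)
  then show ?case using mix assms(2,3) by simp
next
  case (mult u c)
  have "(\<integral>\<^sup>+x. c * u x \<partial>\<nu> k) = c * (\<integral>\<^sup>+x. u x \<partial>\<nu> k)" if "k \<in> I" for k
    using mult(2) assms(3)[OF that] by (subst nn_integral_cmult) (auto cong: measurable_cong_sets)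
  moreover have "(\<integral>\<^sup>+x. c * u x \<partial>\<gamma>) = c * (\<integral>\<^sup>+x. u x \<partial>\<gamma>)"
    using mult(2) by (subst nn_integral_cmult) auto
  ultimately show ?case
    using mult by (simp add: sum_distrib_left mult.left_commute cong: sum.cong)
next
  case (add u v)
  have "(\<integral>\<^sup>+x. v x + u x \<partial>\<nu> k) = (\<integral>\<^sup>+x. v x \<partial>\<nu> k) + (\<integral>\<^sup>+x. u x \<partial>\<nu> k)" if "k \<in> I" for k
    using add assms(3)[OF that] by (subst nn_integral_add) (auto cong: measurable_cong_sets)
  moreover have "(\<integral>\<^sup>+x. v x + u x \<partial>\<gamma>) = (\<integral>\<^sup>+x. v x \<partial>\<gamma>) + (\<integral>\<^sup>+x. u x \<partial>\<gamma>)"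
    using add by (subst nn_integral_add) auto
  ultimately show ?case
    using add by (simp add: sum.distrib distrib_left cong: sum.cong)
next
  case (seq U)
  have Sup: "(\<integral>\<^sup>+x. (SUP i. U i) x \<partial>M) = (SUP i. \<integral>\<^sup>+x. U i x \<partial>M)" if "sets M = sets borel" for M
    using seq(1,3) that
    by (simp add: SUP_apply image_comp)
       (intro nn_integral_monotone_convergence_SUP, auto cong: measurable_cong_sets)
  have "(\<integral>\<^sup>+x. (SUP i. U i) x \<partial>\<gamma>) = (SUP i. \<Sum>k\<in>I. w k * (\<integral>\<^sup>+x. U i x \<partial>\<nu> k))"
    using Sup[OF assms(2)] seq(5) by simp
  also have "\<dots> = (\<Sum>k\<in>I. SUP i. w k * (\<integral>\<^sup>+x. U i x \<partial>\<nu> k))"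
    using seq(3) by (intro ennreal_SUP_sum)
      (auto simp: incseq_def le_fun_def intro!: mult_left_mono nn_integral_mono)
  also have "\<dots> = (\<Sum>k\<in>I. w k * (\<integral>\<^sup>+x. (SUP i. U i) x \<partial>\<nu> k))"
    using Sup[OF assms(3)] by (intro sum.cong) (simp_all add: SUP_mult_left_ennreal)
  finally show ?case .
qed

text \<open>The weight must be positive: a component of weight zero is not seen by the mixture.\<close>

lemma AE_mixture_component:
  fixes \<gamma> :: "'a::topological_space measure" and w :: "'i \<Rightarrow> ennreal"
  assumes "finite I" "sets \<gamma> = sets borel" "k \<in> I" "sets (\<nu> k) = sets borel" "w k > 0"
    and mix: "\<And>E. E \<in> sets borel \<Longrightarrow> emeasure \<gamma> E = (\<Sum>k\<in>I. w k * emeasure (\<nu> k) E)"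
    and "AE x in \<gamma>. P x"
  shows "AE x in \<nu> k. P x"
proof -
  obtain N where N: "N \<in> null_sets \<gamma>" "{x \<in> space \<gamma>. \<not> P x} \<subseteq> N"
    using assms(7) by (auto simp: eventually_ae_filter)
  then have "(\<Sum>k\<in>I. w k * emeasure (\<nu> k) N) = 0" "N \<in> sets borel"
    using mix[of N] assms(2) by (auto simp: null_sets_def)
  then have "N \<in> null_sets (\<nu> k)"
    using assms(1,3-5) by (auto simp: null_sets_def)
  moreover have "{x \<in> space (\<nu> k). \<not> P x} \<subseteq> N"
    using N(2) sets_eq_imp_space_eq[OF assms(2)] sets_eq_imp_space_eq[OF assms(4)] by simp
  ultimately show ?thesis
    by (rule AE_I')
qed

section \<open>Gaussian laws\<close>

lemma sets_std_gaussian [simp, measurable_cong]: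
  "sets (std_gaussian :: 'a::euclidean_space measure) = sets borel"
  by (simp add: std_gaussian_def)

lemma borel_measurable_affine [measurable]:
  fixes A :: "'a::euclidean_space \<Rightarrow> 'b::euclidean_space"
  assumes "linear A"
  shows "(\<lambda>z. m + A z) \<in> borel_measurable borel"
  using assms by (intro borel_measurable_continuous_onI continuous_intros linear_continuous_on)
    (simp add: linear_conv_bounded_linear)

lemma AE_std_gaussian_imp_AE_lborel:
  assumes "AE z in (std_gaussian :: 'a::euclidean_space measure). P z"
  shows "AE z in lborel. P z"
proof -
  have "AE z::'a in lborel. 0 < ennreal (\<Prod>b\<in>Basis. std_normal_density (z \<bullet> b)) \<longrightarrow> P z"
    using assms unfolding std_gaussian_def by (subst (asm) AE_density) auto
  then show ?thesis
  proof (rule eventually_mono)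
    fix z :: 'a
    have "0 < (\<Prod>b\<in>Basis. std_normal_density (z \<bullet> b))"
      by (intro prod_pos ballI normal_density_pos) simp
    then show "P z" if "0 < ennreal (\<Prod>b\<in>Basis. std_normal_density (z \<bullet> b)) \<longrightarrow> P z"
      using that by simp
  qed
qed

text \<open>
  The standard Gaussian has the same null sets as Lebesgue measure and so charges every non-empty
  open set. Hence a closed condition that holds almost surely holds on the whole affine subspace
  \<open>m + range A\<close>, also when \<open>A\<close> is singular and the law itself has no density.
\<close>

lemma AE_gaussian_closed_imp_all:
  fixes A :: "'a::euclidean_space \<Rightarrow> 'a"
  assumes A: "linear A" and cl: "closed {x. P x}"
    and ae: "AE x in distr std_gaussian borel (\<lambda>z. m + A z). P x"
  shows "P (m + A z)"
proof -
  have cont: "continuous_on UNIV (\<lambda>z. m + A z)"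
    using A by (intro continuous_intros linear_continuous_on) (simp add: linear_conv_bounded_linear)
  have "AE z in std_gaussian. P (m + A z)"
    using ae A cl by (subst (asm) AE_distr_iff) auto
  then have "AE z in lborel. P (m + A z)"
    by (rule AE_std_gaussian_imp_AE_lborel)
  then have "AE z in lebesgue. z \<in> {z. P (m + A z)}"
    by (simp add: AE_completion)
  moreover have "closed {z. P (m + A z)}"
    using closed_vimage[OF cl cont] by (simp add: vimage_def)
  ultimately show ?thesis
    using mem_closed_if_AE_lebesgue by blast
qed

text \<open>Finite second moments of the Gaussian components make the cost of a mixture plan finite.\<close>

lemma nn_integral_std_gaussian_norm_square:
  "(\<integral>\<^sup>+z. ennreal ((norm z)\<^sup>2) \<partial>(std_gaussian :: 'a::euclidean_space measure)) < \<infinity>"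
proof -
  have coord: "(\<integral>\<^sup>+z. ennreal ((z \<bullet> b)\<^sup>2) \<partial>(std_gaussian :: 'a measure)) < \<infinity>"
    if b: "b \<in> Basis" for b :: 'a
  proof -
    \<comment> \<open>The integrand is a product over the coordinates; only the factor at \<open>b\<close> carries the square.\<close>
    define g where "g b' x = (if b' = b then std_normal_density x * x\<^sup>2 else std_normal_density x)"
      for b' and x :: real
    have [measurable]: "g b' \<in> borel_measurable borel" for b'
      unfolding g_def by measurable
    have g0: "0 \<le> g b' x" for b' x
      by (simp add: g_def)
    have gfin: "(\<integral>\<^sup>+x. ennreal (g b' x) \<partial>lborel) \<noteq> \<top>" for b'
    proof -
      have "integrable lborel (g b')"
        using integrable_std_normal_moment[of 2] integrable_std_normal_moment[of 0]
        by (cases "b' = b") (simp_all add: g_def[abs_def])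
      then show ?thesis
        using g0 by (simp add: nn_integral_eq_integral)
    qed
    have "(\<integral>\<^sup>+z. ennreal ((z \<bullet> b)\<^sup>2) \<partial>(std_gaussian :: 'a measure))
        = (\<integral>\<^sup>+z. ennreal (\<Prod>b'\<in>Basis. std_normal_density (z \<bullet> b')) * ennreal ((z \<bullet> b)\<^sup>2) \<partial>(lborel :: 'a measure))"
      unfolding std_gaussian_def by (subst nn_integral_density) auto
    also have "\<dots> = (\<integral>\<^sup>+z. (\<Prod>b'\<in>Basis. ennreal (g b' (z \<bullet> b'))) \<partial>(lborel :: 'a measure))"
    proof (intro nn_integral_cong)
      fix z :: 'a
      have "(\<Prod>b'\<in>Basis. g b' (z \<bullet> b')) = (\<Prod>b'\<in>Basis. std_normal_density (z \<bullet> b')) * (z \<bullet> b)\<^sup>2"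
        using b by (simp add: g_def prod.remove[of Basis b])
      then show "ennreal (\<Prod>b'\<in>Basis. std_normal_density (z \<bullet> b')) * ennreal ((z \<bullet> b)\<^sup>2)
          = (\<Prod>b'\<in>Basis. ennreal (g b' (z \<bullet> b')))"
        by (simp add: prod_ennreal g0 ennreal_mult prod_nonneg)
    qed
    also have "\<dots> = (\<Prod>b'\<in>(Basis::'a set). \<integral>\<^sup>+x. ennreal (g b' x) \<partial>lborel)"
      by (rule nn_integral_lborel_prod) auto
    also have "\<dots> \<noteq> \<top>"
      using gfin by (simp add: ennreal_prod_eq_top)
    finally show ?thesis
      by (simp add: less_top)
  qed
  have "(norm z)\<^sup>2 = (\<Sum>b\<in>Basis. (z \<bullet> b)\<^sup>2)" for z :: 'a
    using euclidean_inner[of z z] by (simp only: power2_norm_eq_inner) (simp add: power2_eq_square)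
  then have "(\<integral>\<^sup>+z. ennreal ((norm z)\<^sup>2) \<partial>(std_gaussian :: 'a measure))
      = (\<Sum>b\<in>Basis. \<integral>\<^sup>+z. ennreal ((z \<bullet> b)\<^sup>2) \<partial>(std_gaussian :: 'a measure))"
    by (simp add: nn_integral_sum flip: sum_ennreal)
  then show ?thesis
    using coord by (simp add: less_top)
qed

lemma nn_integral_std_gaussian_affine_norm_square:
  fixes f :: "'a::euclidean_space \<Rightarrow> 'b::euclidean_space"
  assumes "linear f"
  shows "(\<integral>\<^sup>+z. ennreal ((norm (c + f z))\<^sup>2) \<partial>std_gaussian) < \<infinity>"
proof -
  interpret G: prob_space "std_gaussian :: 'a measure"
    by (rule prob_space_std_gaussian)
  obtain B where B: "norm (f z) \<le> B * norm z" for z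
    using linear_bounded[OF assms] by blast
  have bd: "(norm (c + f z))\<^sup>2 \<le> 2 * (norm c)\<^sup>2 + 2 * B\<^sup>2 * (norm z)\<^sup>2" for z
  proof -
    have "(norm (c + f z))\<^sup>2 \<le> (norm c + B * norm z)\<^sup>2"
      using norm_triangle_ineq[of c "f z"] B[of z] by (intro power_mono) auto
    also have "\<dots> \<le> 2 * (norm c)\<^sup>2 + 2 * B\<^sup>2 * (norm z)\<^sup>2"
      using sum_squares_bound[of "norm c" "B * norm z"] by (simp add: power2_sum power_mult_distrib)
    finally show ?thesis .
  qed
  have "(\<integral>\<^sup>+z. ennreal ((norm (c + f z))\<^sup>2) \<partial>std_gaussian)
      \<le> (\<integral>\<^sup>+z. ennreal (2 * (norm c)\<^sup>2) + ennreal (2 * B\<^sup>2) * ennreal ((norm z)\<^sup>2) \<partial>(std_gaussian :: 'a measure))"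
    using bd by (intro nn_integral_mono) (simp add: ennreal_leI flip: ennreal_mult ennreal_plus)
  also have "\<dots> = ennreal (2 * (norm c)\<^sup>2)
      + ennreal (2 * B\<^sup>2) * (\<integral>\<^sup>+z. ennreal ((norm z)\<^sup>2) \<partial>(std_gaussian :: 'a measure))"
    by (simp add: nn_integral_add nn_integral_cmult G.emeasure_space_1)
  also have "\<dots> < \<infinity>"
    using nn_integral_std_gaussian_norm_square[where ?'a='a] by (simp add: ennreal_mult_less_top)
  finally show ?thesis .
qed

section \<open>Optimal plans are monotone\<close>

definition monotone_pair :: "'a::real_inner \<times> 'a \<Rightarrow> 'a \<times> 'a \<Rightarrow> bool" where
  "monotone_pair p q \<longleftrightarrow> 0 \<le> (fst p - fst q) \<bullet> (snd p - snd q)"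

lemma closed_monotone_pair:
  "closed {q. monotone_pair p q}" "closed {p. monotone_pair p q}"
  unfolding monotone_pair_def by (intro closed_Collect_le continuous_intros)+

text \<open>
  The exchange argument is carried out on two independent samples \<open>(x, y)\<close> and \<open>(x', y')\<close> of the
  plan. Replacing \<open>y\<close> by \<open>y'\<close> exactly on the event \<open>W = {\<langle>x - x', y - y'\<rangle> < 0}\<close> gives a
  competitor. Since \<open>W\<close> is symmetric in the two samples, the law of the second coordinate does not
  change, and after symmetrisation the cost drops by the expectation of
  \<open>- \<langle>x - x', y - y'\<rangle>\<close> over \<open>W\<close>. Finiteness of the cost is essential: every plan is optimal when all
  costs are infinite.
\<close>

lemma optimal_plan_AE_monotone:
  fixes \<mu> \<nu> :: "'a::euclidean_space measure"
  assumes opt: "W2_optimal_plan \<mu> \<nu> \<gamma>" and fin: "quadratic_cost \<gamma> < \<infinity>"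
  shows "AE p in \<gamma>. AE q in \<gamma>. monotone_pair p q"
proof -
  have "prob_space \<gamma>" and sets\<gamma>: "sets \<gamma> = sets borel"
    and m0: "distr \<gamma> borel fst = \<mu>" and m1: "distr \<gamma> borel snd = \<nu>"
    using opt by (auto simp: W2_optimal_plan_def couplings_def)
  have sets\<gamma>' [measurable_cong]: "sets \<gamma> = sets (borel \<Otimes>\<^sub>M (borel :: 'a measure))"
    unfolding borel_prod by (rule sets\<gamma>)
  interpret \<gamma>: prob_space \<gamma> by fact
  interpret P: pair_prob_space \<gamma> \<gamma> ..
  define W where "W p q \<longleftrightarrow> (fst p - fst q) \<bullet> (snd p - snd q) < 0" for p q :: "'a \<times> 'a"
  have W_sym: "W q p \<longleftrightarrow> W p q" for p q
    by (simp add: W_def inner_diff algebra_simps)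
  have [measurable]: "Measurable.pred (\<gamma> \<Otimes>\<^sub>M \<gamma>) (\<lambda>z. W (fst z) (snd z))"
    unfolding W_def by measurable
  define s where "s z = (fst (fst z), if W (fst z) (snd z) then snd (snd z) else snd (fst z))"
    for z :: "('a \<times> 'a) \<times> ('a \<times> 'a)"
  have [measurable]: "s \<in> \<gamma> \<Otimes>\<^sub>M \<gamma> \<rightarrow>\<^sub>M borel"
    unfolding s_def borel_prod[symmetric] by measurable
  \<comment> \<open>The competitor: the law of the first sample with its second coordinate exchanged on \<open>W\<close>.\<close>
  define \<gamma>' where "\<gamma>' = distr (\<gamma> \<Otimes>\<^sub>M \<gamma>) borel s"
  have [measurable]: "(fst :: 'a \<times> 'a \<Rightarrow> 'a) \<in> borel_measurable borel"
      "(snd :: 'a \<times> 'a \<Rightarrow> 'a) \<in> borel_measurable borel"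
    by (auto simp: borel_prod[symmetric])

  have swap: "(\<integral>\<^sup>+z. f (snd z) (fst z) \<partial>(\<gamma> \<Otimes>\<^sub>M \<gamma>)) = (\<integral>\<^sup>+z. f (fst z) (snd z) \<partial>(\<gamma> \<Otimes>\<^sub>M \<gamma>))"
    if [measurable]: "(\<lambda>z. f (fst z) (snd z)) \<in> borel_measurable (\<gamma> \<Otimes>\<^sub>M \<gamma>)"
    for f :: "'a \<times> 'a \<Rightarrow> 'a \<times> 'a \<Rightarrow> ennreal"
    by (subst (2) P.distr_pair_swap) (simp add: nn_integral_distr split_beta)
  have fst_law: "(\<integral>\<^sup>+z. f (fst z) \<partial>(\<gamma> \<Otimes>\<^sub>M \<gamma>)) = (\<integral>\<^sup>+p. f p \<partial>\<gamma>)"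
    if [measurable]: "f \<in> borel_measurable \<gamma>" for f :: "'a \<times> 'a \<Rightarrow> ennreal"
    by (subst (3) \<gamma>.distr_pair_fst[symmetric, of \<gamma>]) (simp add: nn_integral_distr)

  have "distr \<gamma>' borel fst = \<mu>"
  proof -
    have "distr \<gamma>' borel fst = distr (\<gamma> \<Otimes>\<^sub>M \<gamma>) borel (fst \<circ> fst)"
      unfolding \<gamma>'_def by (subst distr_distr) (auto simp: s_def comp_def)
    also have "\<dots> = distr (distr (\<gamma> \<Otimes>\<^sub>M \<gamma>) \<gamma> fst) borel fst"
      by (subst distr_distr) auto
    finally show ?thesis
      using m0 \<gamma>.distr_pair_fst[of \<gamma>] by simp
  qed
  moreover have "distr \<gamma>' borel snd = \<nu>"
  proof (rule measure_eqI)
    show "sets (distr \<gamma>' borel snd) = sets \<nu>"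
      by (simp flip: m1)
    fix E assume "E \<in> sets (distr \<gamma>' borel snd)"
    then have [measurable]: "E \<in> sets borel" by simp
    let ?i = "\<lambda>p. indicator E (snd p) :: ennreal"
    have "emeasure (distr \<gamma>' borel snd) E = (\<integral>\<^sup>+y. indicator E y \<partial>distr \<gamma>' borel snd)"
      by simp
    also have "\<dots> = (\<integral>\<^sup>+z. ?i (s z) \<partial>(\<gamma> \<Otimes>\<^sub>M \<gamma>))"
      unfolding \<gamma>'_def by (subst nn_integral_distr, simp, simp, subst nn_integral_distr) auto
    also have "\<dots> = (\<integral>\<^sup>+z. (if W (fst z) (snd z) then ?i (snd z) else 0)
        + (if W (fst z) (snd z) then 0 else ?i (fst z)) \<partial>(\<gamma> \<Otimes>\<^sub>M \<gamma>))"
      by (intro nn_integral_cong) (simp add: s_def)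
    also have "\<dots> = (\<integral>\<^sup>+z. (if W (fst z) (snd z) then ?i (snd z) else 0) \<partial>(\<gamma> \<Otimes>\<^sub>M \<gamma>))
        + (\<integral>\<^sup>+z. (if W (fst z) (snd z) then 0 else ?i (fst z)) \<partial>(\<gamma> \<Otimes>\<^sub>M \<gamma>))"
      by (intro nn_integral_add) measurable
    \<comment> \<open>Renaming the two samples turns the exchanged part back into the original one.\<close>
    also have "(\<integral>\<^sup>+z. (if W (fst z) (snd z) then ?i (snd z) else 0) \<partial>(\<gamma> \<Otimes>\<^sub>M \<gamma>))
        = (\<integral>\<^sup>+z. (if W (fst z) (snd z) then ?i (fst z) else 0) \<partial>(\<gamma> \<Otimes>\<^sub>M \<gamma>))"
      using swap[of "\<lambda>p q. if W p q then ?i p else 0"] by (simp add: W_sym)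
    also have "(\<integral>\<^sup>+z. (if W (fst z) (snd z) then ?i (fst z) else 0) \<partial>(\<gamma> \<Otimes>\<^sub>M \<gamma>))
          + (\<integral>\<^sup>+z. (if W (fst z) (snd z) then 0 else ?i (fst z)) \<partial>(\<gamma> \<Otimes>\<^sub>M \<gamma>))
        = (\<integral>\<^sup>+z. (if W (fst z) (snd z) then ?i (fst z) else 0)
          + (if W (fst z) (snd z) then 0 else ?i (fst z)) \<partial>(\<gamma> \<Otimes>\<^sub>M \<gamma>))"
      by (intro nn_integral_add[symmetric]) measurable
    also have "\<dots> = (\<integral>\<^sup>+z. ?i (fst z) \<partial>(\<gamma> \<Otimes>\<^sub>M \<gamma>))"
      by (intro nn_integral_cong) simp
    also have "\<dots> = (\<integral>\<^sup>+p. ?i p \<partial>\<gamma>)"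
      by (rule fst_law) measurable
    also have "\<dots> = (\<integral>\<^sup>+y. indicator E y \<partial>distr \<gamma> borel snd)"
      by (subst nn_integral_distr) auto
    also have "\<dots> = emeasure \<nu> E"
      by (simp flip: m1)
    finally show "emeasure (distr \<gamma>' borel snd) E = emeasure \<nu> E" .
  qed
  moreover have "prob_space \<gamma>'"
    unfolding \<gamma>'_def by (rule P.prob_space_distr) measurable
  ultimately have "\<gamma>' \<in> couplings \<mu> \<nu>"
    by (simp add: couplings_def \<gamma>'_def)
  with opt have le: "quadratic_cost \<gamma> \<le> quadratic_cost \<gamma>'"
    by (simp add: W2_optimal_plan_def)

  \<comment> \<open>All terms are kept non-negative, so that the comparison needs no subtraction of infinite
    quantities: \<open>D\<close> is the saving of the two exchanges together, and \<open>a\<close> the new cost.\<close>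
  define c where "c p q = ennreal ((norm (fst p - snd q))\<^sup>2)" for p q :: "'a \<times> 'a"
  define a where "a p q = (if W p q then c p q else c p p)" for p q
  define D where "D p q = ennreal (if W p q then - 2 * ((fst p - fst q) \<bullet> (snd p - snd q)) else 0)"
    for p q :: "'a \<times> 'a"
  have [measurable]: "(\<lambda>z. a (fst z) (snd z)) \<in> borel_measurable (\<gamma> \<Otimes>\<^sub>M \<gamma>)"
      "(\<lambda>z. a (snd z) (fst z)) \<in> borel_measurable (\<gamma> \<Otimes>\<^sub>M \<gamma>)"
      "(\<lambda>z. D (fst z) (snd z)) \<in> borel_measurable (\<gamma> \<Otimes>\<^sub>M \<gamma>)"
      "(\<lambda>p. c p p) \<in> borel_measurable \<gamma>"
    unfolding a_def c_def D_def W_def by measurable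
  have cost: "quadratic_cost \<gamma> = (\<integral>\<^sup>+z. c (fst z) (fst z) \<partial>(\<gamma> \<Otimes>\<^sub>M \<gamma>))"
    by (subst fst_law) (auto simp: quadratic_cost_def c_def case_prod_unfold)
  have cost': "quadratic_cost \<gamma>' = (\<integral>\<^sup>+z. a (fst z) (snd z) \<partial>(\<gamma> \<Otimes>\<^sub>M \<gamma>))"
    unfolding quadratic_cost_def \<gamma>'_def
    by (subst nn_integral_distr) (auto simp: case_prod_unfold a_def c_def s_def if_distrib intro!: nn_integral_cong)
  have pointwise: "c p p + c q q = a p q + a q p + D p q" for p q
  proof (cases "W p q")
    case True
    have "(norm (fst p - snd p))\<^sup>2 + (norm (fst q - snd q))\<^sup>2
        = (norm (fst p - snd q))\<^sup>2 + (norm (fst q - snd p))\<^sup>2 + - 2 * ((fst p - fst q) \<bullet> (snd p - snd q))"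
      by (simp add: power2_norm_eq_inner inner_diff inner_commute algebra_simps)
    with True show ?thesis
      by (simp add: a_def c_def D_def W_sym W_def flip: ennreal_plus)
  next
    case False
    then show ?thesis by (simp add: a_def D_def W_sym)
  qed
  let ?\<delta> = "\<integral>\<^sup>+z. D (fst z) (snd z) \<partial>(\<gamma> \<Otimes>\<^sub>M \<gamma>)"
  have "quadratic_cost \<gamma> + quadratic_cost \<gamma>
      = (\<integral>\<^sup>+z. c (fst z) (fst z) \<partial>(\<gamma> \<Otimes>\<^sub>M \<gamma>)) + (\<integral>\<^sup>+z. c (snd z) (snd z) \<partial>(\<gamma> \<Otimes>\<^sub>M \<gamma>))"
    using cost swap[of "\<lambda>p q. c p p"] by simp
  also have "\<dots> = (\<integral>\<^sup>+z. c (fst z) (fst z) + c (snd z) (snd z) \<partial>(\<gamma> \<Otimes>\<^sub>M \<gamma>))"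
    by (intro nn_integral_add[symmetric]) measurable
  also have "\<dots> = (\<integral>\<^sup>+z. a (fst z) (snd z) + a (snd z) (fst z) + D (fst z) (snd z) \<partial>(\<gamma> \<Otimes>\<^sub>M \<gamma>))"
    by (simp only: pointwise)
  also have "\<dots> = quadratic_cost \<gamma>' + quadratic_cost \<gamma>' + ?\<delta>"
    using swap[of a] by (simp add: nn_integral_add cost')
  finally have eq: "quadratic_cost \<gamma> + quadratic_cost \<gamma> = quadratic_cost \<gamma>' + quadratic_cost \<gamma>' + ?\<delta>" .
  have "?\<delta> = 0"
  proof -
    have "quadratic_cost \<gamma> + quadratic_cost \<gamma> + ?\<delta> \<le> quadratic_cost \<gamma>' + quadratic_cost \<gamma>' + ?\<delta>"
      using le by (intro add_mono) auto
    also have "\<dots> = quadratic_cost \<gamma> + quadratic_cost \<gamma> + 0"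
      using eq by simp
    finally show ?thesis
      using fin by (simp only: ennreal_add_left_cancel_le) (auto simp: less_top)
  qed
  then have "AE z in \<gamma> \<Otimes>\<^sub>M \<gamma>. D (fst z) (snd z) = 0"
    by (subst (asm) nn_integral_0_iff_AE) auto
  then have "AE z in \<gamma> \<Otimes>\<^sub>M \<gamma>. monotone_pair (fst z) (snd z)"
    by (rule eventually_mono) (auto simp: D_def W_def monotone_pair_def split: if_splits)
  then show ?thesis
    using P.AE_pair by fastforce
qed

section \<open>Monotone families of affine subspaces\<close>

text \<open>
  Let \<open>\<delta>\<close> be the gap between the second coordinates. Moving the second point by \<open>t\<close> along a direction
  of its subspace that projects to \<open>\<delta>\<close> changes the first coordinate by \<open>t * \<delta>\<close>, and monotonicity reads
  \<open>t * (norm \<delta>)\<^sup>2 \<le> t\<^sup>2 * e\<close> with \<open>e\<close> independent of \<open>t\<close>; small \<open>t > 0\<close> force \<open>\<delta> = 0\<close>. Taking both subspaces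
  equal shows that a single subspace is a graph, taking them different shows that the graphs agree.
\<close>

lemma monotone_affine_pair_agree:
  fixes A A' :: "'z::real_vector \<Rightarrow> 'a::real_inner \<times> 'a"
  assumes A': "linear A'" and surj: "surj (\<lambda>z. fst (A' z))"
    and mono: "\<And>z z'. monotone_pair (m + A z) (m' + A' z')"
    and eq: "fst (m + A z) = fst (m' + A' z')"
  shows "snd (m + A z) = snd (m' + A' z')"
proof -
  define \<delta> where "\<delta> = snd (m + A z) - snd (m' + A' z')"
  obtain u where u: "fst (A' u) = \<delta>"
    using surj by (metis surjD)
  define e where "e = \<delta> \<bullet> snd (A' u)"
  have ineq: "t * (\<delta> \<bullet> \<delta>) \<le> t * t * e" for t :: real
  proof -
    have "A' (z' + t *\<^sub>R u) = A' z' + t *\<^sub>R A' u"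
      using A' by (simp add: linear_add linear_cmul)
    then have "fst (m + A z) - fst (m' + A' (z' + t *\<^sub>R u)) = - t *\<^sub>R \<delta>"
        "snd (m + A z) - snd (m' + A' (z' + t *\<^sub>R u)) = \<delta> - t *\<^sub>R snd (A' u)"
      using eq u by (simp_all add: \<delta>_def)
    then show ?thesis
      using mono[of z "z' + t *\<^sub>R u"]
      unfolding monotone_pair_def by (simp only:) (simp add: inner_diff_right e_def algebra_simps)
  qed
  have "\<delta> \<bullet> \<delta> \<le> 0"
  proof (cases "e > 0")
    case True
    \<comment> \<open>The choice \<open>t = (\<delta> \<bullet> \<delta>) / (2 * e)\<close> makes the quadratic term half of the linear one.\<close>
    have "(\<delta> \<bullet> \<delta>) / (2 * e) * (\<delta> \<bullet> \<delta>) \<le> (\<delta> \<bullet> \<delta>) / (2 * e) * ((\<delta> \<bullet> \<delta>) / (2 * e)) * e"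
      by (rule ineq)
    with True have "(\<delta> \<bullet> \<delta>) * (\<delta> \<bullet> \<delta>) \<le> 0"
      by (simp add: field_simps)
    then show ?thesis
      by (simp add: mult_le_0_iff)
  next
    case False
    then show ?thesis using ineq[of 1] by simp
  qed
  then have "\<delta> = 0"
    by (metis inner_eq_zero_iff inner_ge_zero order_antisym)
  then show ?thesis
    by (simp add: \<delta>_def)
qed

text \<open>
  The common map is read off from one member of the family, through a linear right inverse of its
  projection to the first coordinate; every other point is compared with the point of that member
  above the same first coordinate.
\<close>

lemma monotone_affine_family_on_graph:
  fixes A :: "'i \<Rightarrow> 'z::euclidean_space \<Rightarrow> 'a::euclidean_space \<times> 'a"
  assumes ne: "I \<noteq> {}" and A: "\<And>k. k \<in> I \<Longrightarrow> linear (A k)"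
    and surj: "\<And>k. k \<in> I \<Longrightarrow> surj (\<lambda>z. fst (A k z))"
    and mono: "\<And>k l z z'. k \<in> I \<Longrightarrow> l \<in> I \<Longrightarrow> monotone_pair (m k + A k z) (m l + A l z')"
  obtains f b where "linear f" "\<And>k z. k \<in> I \<Longrightarrow> snd (m k + A k z) = f (fst (m k + A k z)) + b"
proof -
  obtain k0 where k0: "k0 \<in> I" using ne by blast
  have "linear (\<lambda>z. fst (A k0 z))"
    using linear_compose[OF A[OF k0] linear_fst] by (simp add: comp_def)
  then obtain B where B: "linear B" "(\<lambda>z. fst (A k0 z)) \<circ> B = id"
    using linear_surjective_right_inverse surj[OF k0] by blast
  define f where "f x = snd (A k0 (B x))" for x
  have f: "linear f"
    using linear_compose[OF linear_compose[OF B(1) A[OF k0]] linear_snd] by (simp add: comp_def f_def[abs_def])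
  have "snd (m k + A k z) = f (fst (m k + A k z)) + (snd (m k0) - f (fst (m k0)))" if "k \<in> I" for k z
  proof -
    define x where "x = fst (m k + A k z)"
    have "fst (A k0 (B y)) = y" for y
      using B(2) by (metis comp_apply id_apply)
    then have "fst (m k + A k z) = fst (m k0 + A k0 (B (x - fst (m k0))))"
      by (simp add: x_def)
    then have "snd (m k + A k z) = snd (m k0 + A k0 (B (x - fst (m k0))))"
      by (intro monotone_affine_pair_agree[OF A surj mono] that k0)
    also have "\<dots> = f (x - fst (m k0)) + snd (m k0)"
      by (simp add: f_def)
    finally show ?thesis
      using f by (simp add: x_def linear_diff)
  qed
  with f that show ?thesis by blast
qed

text \<open>If \<open>A\<close> were not onto, \<open>m + range A\<close> would lie in a hyperplane, which is a Lebesgue null set.\<close>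

lemma affine_image_in_no_null_set_imp_surj:
  fixes A :: "'z::euclidean_space \<Rightarrow> 'a::euclidean_space"
  assumes A: "linear A" and null: "\<And>N. N \<in> null_sets lborel \<Longrightarrow> \<exists>z. m + A z \<notin> N"
  shows "surj A"
proof (rule ccontr)
  assume "\<not> surj A"
  moreover have "span (range A) = range A"
    using A by (simp add: span_eq_iff linear_subspace_image)
  ultimately have "span (range A) \<noteq> UNIV" by metis
  then obtain a where a: "a \<noteq> 0" "\<And>x. x \<in> span (range A) \<Longrightarrow> a \<bullet> x = 0"
    using span_not_UNIV_orthogonal by blast
  let ?H = "{x. a \<bullet> x = a \<bullet> m}"
  have "?H \<in> null_sets lebesgue"
    using negligible_hyperplane[of a "a \<bullet> m"] a(1) by (simp add: negligible_iff_null_sets)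
  then have "?H \<in> null_sets lborel"
    by (simp add: null_sets_completion_iff closed_hyperplane)
  then obtain z where "m + A z \<notin> ?H"
    using null by blast
  moreover have "a \<bullet> A z = 0"
    by (rule a(2)) (simp add: span_base)
  ultimately show False
    by (simp add: inner_add_right)
qed

section \<open>Optimal Gaussian-mixture plans are affine\<close>

text \<open>
  Everything is transferred from the plan to its components of positive weight, because an almost
  sure property of a mixture is one of each of them, and because the second moments of the
  components bound the cost. The affine map found on their supports then carries \<open>\<mu>0\<close> to \<open>\<mu>1\<close>, since
  the plan is concentrated on its graph.
\<close>

theorem optimal_GMM_plan_imp_affine:
  fixes \<mu>0 \<mu>1 :: "'a::euclidean_space measure"
  assumes ac: "absolutely_continuous lborel \<mu>0"
    and opt: "W2_optimal_plan \<mu>0 \<mu>1 \<gamma>" and gmm: "\<gamma> \<in> GMM_inf"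
  obtains f b where "linear f" "\<mu>1 = distr \<mu>0 borel (\<lambda>x. f x + b)"
proof -
  obtain K where "\<gamma> \<in> GMM K"
    using gmm by (auto simp: GMM_inf_def)
  then obtain \<pi> m S \<nu> where \<gamma>: "prob_space \<gamma>"
    and sets\<gamma> [measurable_cong]: "sets \<gamma> = sets borel"
    and comp: "\<And>k. k < K \<Longrightarrow> 0 \<le> \<pi> k \<and> gaussian_law (m k) (S k) (\<nu> k)"
    and sum1: "(\<Sum>k<K. \<pi> k) = (1::real)"
    and meas: "\<And>E. E \<in> sets borel \<Longrightarrow> measure \<gamma> E = (\<Sum>k<K. \<pi> k * measure (\<nu> k) E)"
    unfolding GMM_def by blast
  have m0: "distr \<gamma> borel fst = \<mu>0" and m1: "distr \<gamma> borel snd = \<mu>1"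
    using opt by (auto simp: W2_optimal_plan_def couplings_def)
  have "\<exists>A :: 'a \<times> 'a \<Rightarrow> 'a \<times> 'a. linear A \<and> \<nu> k = distr std_gaussian borel (\<lambda>z. m k + A z)"
    if "k < K" for k
    using comp[OF that] unfolding gaussian_law_def by blast
  then obtain A :: "_ \<Rightarrow> 'a \<times> 'a \<Rightarrow> 'a \<times> 'a" where A: "\<And>k. k < K \<Longrightarrow> linear (A k)"
    and \<nu>: "\<And>k. k < K \<Longrightarrow> \<nu> k = distr std_gaussian borel (\<lambda>z. m k + A k z)"
    by metis
  have prob: "prob_space (\<nu> k)" if "k < K" for k
    using A[OF that] by (simp add: \<nu>[OF that] prob_space.prob_space_distr prob_space_std_gaussian)
  have sets\<nu>: "sets (\<nu> k) = sets borel" if "k < K" for k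
    by (simp add: \<nu>[OF that])
  interpret \<gamma>: prob_space \<gamma> by fact
  have [measurable]: "(fst :: 'a \<times> 'a \<Rightarrow> 'a) \<in> borel_measurable borel"
      "(snd :: 'a \<times> 'a \<Rightarrow> 'a) \<in> borel_measurable borel"
    by (auto simp: borel_prod[symmetric])
  have mix: "emeasure \<gamma> E = (\<Sum>k<K. ennreal (\<pi> k) * emeasure (\<nu> k) E)" if "E \<in> sets borel" for E
  proof -
    have "ennreal (\<pi> k) * emeasure (\<nu> k) E = ennreal (\<pi> k * measure (\<nu> k) E)" if "k < K" for k
      using comp[OF that] prob_space.finite_measure[OF prob[OF that]]
      by (simp add: finite_measure.emeasure_eq_measure ennreal_mult)
    then have "(\<Sum>k<K. ennreal (\<pi> k) * emeasure (\<nu> k) E) = ennreal (\<Sum>k<K. \<pi> k * measure (\<nu> k) E)"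
      using comp by (subst sum_ennreal[symmetric]) auto
    then show ?thesis
      using meas[OF that] by (simp add: \<gamma>.emeasure_eq_measure)
  qed
  define I where "I = {k. k < K \<and> 0 < \<pi> k}"
  have "I \<noteq> {}"
  proof
    assume "I = {}"
    then have "(\<Sum>k<K. \<pi> k) = 0"
      using comp by (intro sum.neutral) (force simp: I_def)
    then show False using sum1 by simp
  qed
  have comp_AE: "AE p in \<nu> k. P p" if "k \<in> I" "AE p in \<gamma>. P p" for k P
    using that by (intro AE_mixture_component[OF _ sets\<gamma> _ sets\<nu> _ mix]) (auto simp: I_def)

  have "quadratic_cost \<gamma> < \<infinity>"
  proof -
    have "(\<integral>\<^sup>+p. ennreal ((norm (fst p - snd p))\<^sup>2) \<partial>\<nu> k) < \<infinity>" if k: "k < K" for k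
    proof -
      have lin: "linear (\<lambda>z. fst (A k z) - snd (A k z))"
        using A[OF k] by (auto simp: linear_iff algebra_simps)
      have "(\<integral>\<^sup>+p. ennreal ((norm (fst p - snd p))\<^sup>2) \<partial>\<nu> k)
          = (\<integral>\<^sup>+z. ennreal ((norm ((fst (m k) - snd (m k)) + (fst (A k z) - snd (A k z))))\<^sup>2) \<partial>std_gaussian)"
        unfolding \<nu>[OF k] using A[OF k]
        by (subst nn_integral_distr) (auto simp: algebra_simps)
      then show ?thesis
        using nn_integral_std_gaussian_affine_norm_square[OF lin] by simp
    qed
    moreover have "quadratic_cost \<gamma> = (\<Sum>k<K. ennreal (\<pi> k) * (\<integral>\<^sup>+p. ennreal ((norm (fst p - snd p))\<^sup>2) \<partial>\<nu> k))"
      unfolding quadratic_cost_def case_prod_unfold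
      by (rule nn_integral_mixture[OF _ sets\<gamma> sets\<nu> mix]) auto
    ultimately show ?thesis
      by (simp add: ennreal_mult_less_top)
  qed
  from optimal_plan_AE_monotone[OF opt this]
  have ae: "AE p in \<gamma>. AE q in \<gamma>. monotone_pair p q" .
  \<comment> \<open>The passage from almost all to all points is made for one argument at a time: first for the
    second point with the first one fixed, then for the first.\<close>
  have mono: "monotone_pair (m k + A k z) (m l + A l z')" if "k \<in> I" "l \<in> I" for k l z z'
  proof -
    have kl: "k < K" "l < K" using that by (auto simp: I_def)
    have "AE p in \<gamma>. \<forall>z'. monotone_pair p (m l + A l z')"
      using ae
    proof (rule eventually_mono, intro allI)
      fix p z' assume "AE q in \<gamma>. monotone_pair p q"
      then have "AE q in distr std_gaussian borel (\<lambda>z. m l + A l z). monotone_pair p q"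
        unfolding \<nu>[OF kl(2), symmetric] by (rule comp_AE[OF that(2)])
      then show "monotone_pair p (m l + A l z')"
        by (rule AE_gaussian_closed_imp_all[OF A[OF kl(2)] closed_monotone_pair(1)])
    qed
    from comp_AE[OF that(1) this]
    have "AE p in distr std_gaussian borel (\<lambda>z. m k + A k z). \<forall>z'. monotone_pair p (m l + A l z')"
      unfolding \<nu>[OF kl(1)] .
    then have "\<forall>z'. monotone_pair (m k + A k z) (m l + A l z')"
      by (rule AE_gaussian_closed_imp_all[OF A[OF kl(1)]
            closed_Collect_all[OF closed_monotone_pair(2)]])
    then show ?thesis by blast
  qed
  have surj: "surj (\<lambda>z. fst (A k z))" if "k \<in> I" for k
  proof (rule affine_image_in_no_null_set_imp_surj[where m = "fst (m k)"])
    have k: "k < K" using that by (simp add: I_def)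
    show "linear (\<lambda>z. fst (A k z))"
      using linear_compose[OF A[OF k] linear_fst] by (simp add: comp_def)
    fix N :: "'a set" assume "N \<in> null_sets lborel"
    then have "N \<in> null_sets \<mu>0"
      using ac by (auto simp: absolutely_continuous_def)
    then have "AE x in distr \<gamma> borel fst. x \<notin> N"
      by (simp add: m0 AE_not_in)
    moreover have N: "N \<in> sets borel"
      using \<open>N \<in> null_sets lborel\<close> by (simp add: null_sets_def)
    ultimately have "AE p in \<gamma>. fst p \<notin> N"
      by (subst (asm) AE_distr_iff) auto
    from comp_AE[OF that this] N have "AE z in std_gaussian. fst (m k + A k z) \<notin> N"
      unfolding \<nu>[OF k] using A[OF k] by (subst (asm) AE_distr_iff) auto
    then have "\<exists>z. fst (m k + A k z) \<notin> N"
      using prob_space.AE_contr[OF prob_space_std_gaussian, of "\<lambda>z. fst (m k + A k z) \<notin> N"] by force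
    then show "\<exists>z. fst (m k) + fst (A k z) \<notin> N" by simp
  qed
  have linI: "linear (A k)" if "k \<in> I" for k
    using that A by (simp add: I_def)
  obtain f b where f: "linear f"
    and graph: "\<And>k z. k \<in> I \<Longrightarrow> snd (m k + A k z) = f (fst (m k + A k z)) + b"
    using monotone_affine_family_on_graph[where A = A and m = m, OF \<open>I \<noteq> {}\<close> linI surj mono]
    by blast
  have f_meas [measurable]: "(\<lambda>x. f x + b) \<in> borel_measurable borel"
    using borel_measurable_affine[OF f, of b] by (simp add: add.commute)
  have "AE p in \<gamma>. snd p = f (fst p) + b"
  proof -
    let ?N = "{p. snd p \<noteq> f (fst p) + b}"
    have N: "?N \<in> sets borel"
      using f_meas by measurable
    have "ennreal (\<pi> k) * emeasure (\<nu> k) ?N = 0" if "k < K" for k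
    proof (cases "k \<in> I")
      case True
      then show ?thesis
        unfolding \<nu>[OF that] using graph[OF True] A[OF that] N
        by (subst emeasure_distr) auto
    next
      case False
      then show ?thesis using that comp[OF that] by (simp add: I_def)
    qed
    then have "?N \<in> null_sets \<gamma>"
      using N by (simp add: null_sets_def mix sets\<gamma>)
    then show ?thesis
      by (rule AE_I') auto
  qed
  then have "distr \<gamma> borel snd = distr \<gamma> borel (\<lambda>p. f (fst p) + b)"
    by (intro distr_cong_AE) auto
  also have "\<dots> = distr (distr \<gamma> borel fst) borel (\<lambda>x. f x + b)"
    by (subst distr_distr) (auto simp: comp_def)
  finally show ?thesis
    using that[OF f] m0 m1 by simp
qed

theorem proposition3:
  fixes \<mu>0 \<mu>1 :: "(real ^ 'd) measure"
    and \<gamma> :: "((real ^ 'd) \<times> (real ^ 'd)) measure"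
    and K0 K1 :: nat
  assumes "\<mu>0 \<in> GMM K0" and "\<mu>1 \<in> GMM K1"
    and "\<nexists>(A :: real ^ 'd ^ 'd) b. \<mu>1 = distr \<mu>0 borel (\<lambda>x. A *v x + b)"
    and "absolutely_continuous lborel \<mu>0"
    and "W2_optimal_plan \<mu>0 \<mu>1 \<gamma>"
  shows "\<gamma> \<notin> GMM_inf"
proof
  assume "\<gamma> \<in> GMM_inf"
  then obtain f b where "linear f" "\<mu>1 = distr \<mu>0 borel (\<lambda>x. f x + b)"
    using optimal_GMM_plan_imp_affine assms(4,5) by blast
  then have "\<mu>1 = distr \<mu>0 borel (\<lambda>x. matrix f *v x + b)"
    by (simp add: matrix_works)
  with assms(3) show False by blast
qed

end
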